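(* Let $n$ be a positive integer. Then \[ \sum_{\beta \in B_{2n}}(-1)^{\ell_B(\beta)}q^{\operatorname{fmaj}(\beta)} =\prod_{i=1}^n(1-q^{4i-2})\sum_{\beta \in B_n}q^{2\operatorname{fmaj}(\beta)} .\]
   Context: $B_m$ is the group of bijections $\beta$ of $[-m,m]\setminus\{0\}$ with $\beta(-i)=-\beta(i)$, written in window notation $\beta=[\beta_1,\dots,\beta_m]$ with $\beta_i=\beta(i)$. For $\beta\in B_m$: $\operatorname{inv}(\beta)=|\{(i,j): 1\le i<j\le m,\ \beta_i>\beta_j\}|$ (usual order on integers); $\operatorname{N}_1(\beta)=|\{i:\beta_i<0\}|$; $\operatorname{N}_2(\beta)=|\{\{i,j\}: i\neq j,\ \beta_i+\beta_j<0\}|$; the Coxeter length is $\ell_B(\beta)=\operatorname{inv}(\beta)+\operatorname{N}_1(\beta)+\operatorname{N}_2(\beta)$. The descent set $\operatorname{Des}(\beta)$ is the set of $i\in[m-1]$ with $\beta_i\succ\beta_{i+1}$, where $\prec$ is the total order $-1\prec-2\prec\cdots\prec-m\prec 1\prec 2\prec\cdots\prec m$; $\operatorname{maj}(\beta)=\sum_{i\in\operatorname{Des}(\beta)}i$ and $\operatorname{fmaj}(\beta)=2\operatorname{maj}(\beta)+\operatorname{N}_1(\beta)$. *)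

theory Defs
  imports "HOL-Combinatorics.Permutations" "HOL-Computational_Algebra.Polynomial"
begin

(* Elements are total functions on int. The predicate permutes makes them the identity
   outside [-m, m] - {0}, so distinct functions are distinct bijections of that set. *)
definition signed_perms :: "nat \<Rightarrow> (int \<Rightarrow> int) set" where
  "signed_perms m =
     {\<beta>. \<beta> permutes ({- int m..int m} - {0}) \<and>
         (\<forall>i \<in> {- int m..int m} - {0}. \<beta> (- i) = - \<beta> i)}"

definition entry :: "(int \<Rightarrow> int) \<Rightarrow> nat \<Rightarrow> int" where
  "entry \<beta> i = \<beta> (int i)"

definition inversions :: "nat \<Rightarrow> (int \<Rightarrow> int) \<Rightarrow> nat" where
  "inversions m \<beta> = card {(i, j). 1 \<le> i \<and> i < j \<and> j \<le> m \<and> entry \<beta> i > entry \<beta> j}"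

definition N1 :: "nat \<Rightarrow> (int \<Rightarrow> int) \<Rightarrow> nat" where
  "N1 m \<beta> = card {i \<in> {1..m}. entry \<beta> i < 0}"

definition N2 :: "nat \<Rightarrow> (int \<Rightarrow> int) \<Rightarrow> nat" where
  "N2 m \<beta> =
     card {{i, j} | i j. i \<in> {1..m} \<and> j \<in> {1..m} \<and> i \<noteq> j \<and> entry \<beta> i + entry \<beta> j < 0}"

definition length_B :: "nat \<Rightarrow> (int \<Rightarrow> int) \<Rightarrow> nat" where
  "length_B m \<beta> = inversions m \<beta> + N1 m \<beta> + N2 m \<beta>"

(* The order -1, -2, ..., -m, 1, 2, ..., m on nonzero integers (for all m at once);
   0 is incomparable to everything and never occurs as an entry. *)
definition prec :: "int \<Rightarrow> int \<Rightarrow> bool" (infix "\<prec>" 50) where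
  "a \<prec> b \<longleftrightarrow> (a < 0 \<and> b < 0 \<and> b < a) \<or> (a < 0 \<and> 0 < b) \<or> (0 < a \<and> a < b)"

definition Des :: "nat \<Rightarrow> (int \<Rightarrow> int) \<Rightarrow> nat set" where
  "Des m \<beta> = {i \<in> {1..<m}. entry \<beta> (i + 1) \<prec> entry \<beta> i}"

definition maj :: "nat \<Rightarrow> (int \<Rightarrow> int) \<Rightarrow> nat" where
  "maj m \<beta> = (\<Sum>i \<in> Des m \<beta>. i)"

definition fmaj :: "nat \<Rightarrow> (int \<Rightarrow> int) \<Rightarrow> nat" where
  "fmaj m \<beta> = 2 * maj m \<beta> + N1 m \<beta>"

lemma finite_signed_perms: "finite (signed_perms m)"
  by (rule finite_subset[OF _ finite_permutations[of "{- int m..int m} - {0}"]])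
    (auto simp: signed_perms_def)

end

theory Submission
  imports Defs
begin

text \<open>
  Exchanging the values \<open>2k - 1\<close> and \<open>2k\<close> in absolute value, signs kept, reverses the parity of the
  length. It preserves the flag major index unless these two values stand in adjacent positions
  with equal signs. Hence everything cancels except the signed permutations in which this happens
  for every \<open>k\<close>. There the pairs must fill the positions \<open>2j - 1, 2j\<close>, so such a permutation is a
  \<open>\<gamma> \<in> B\<^sub>n\<close> with each entry doubled, together with the set \<open>E\<close> of those \<open>j\<close> whose pair is in
  decreasing absolute order. Its sign is \<open>(-1)\<close> to the power \<open>|E|\<close>, and its flag major index is
  \<open>2 fmaj(\<gamma>)\<close> plus the sum of \<open>4j - 2\<close> over \<open>E\<close>; summing over \<open>E\<close> gives the product.
\<close>

section \<open>Signed permutations as odd functions on all integers\<close>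

text \<open>Off its symmetric support \<open>\<beta>\<close> is the identity, so oddness extends to
  every integer. The last fact holds because equal absolute values mean
  \<open>\<beta> x = \<beta> y\<close> or \<open>\<beta> x = \<beta> (- y)\<close>.\<close>

lemma signed_permsD:
  assumes "\<beta> \<in> signed_perms m"
  shows signed_perms_minus: "\<beta> (- x) = - \<beta> x"
    and signed_perms_outside: "\<bar>x\<bar> > int m \<Longrightarrow> \<beta> x = x"
    and signed_perms_eq_0_iff: "\<beta> x = 0 \<longleftrightarrow> x = 0"
    and signed_perms_bound: "\<bar>x\<bar> \<le> int m \<Longrightarrow> \<bar>\<beta> x\<bar> \<le> int m"
    and signed_perms_abs_eq_iff: "\<bar>\<beta> x\<bar> = \<bar>\<beta> y\<bar> \<longleftrightarrow> \<bar>x\<bar> = \<bar>y\<bar>"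
proof -
  let ?S = "{- int m..int m} - {0}"
  have p: "\<beta> permutes ?S" and odd: "\<And>i. i \<in> ?S \<Longrightarrow> \<beta> (- i) = - \<beta> i"
    using assms by (auto simp: signed_perms_def)
  have out: "\<beta> z = z" if "z \<notin> ?S" for z
    using p that by (simp add: permutes_not_in)
  have zero: "\<beta> 0 = 0" by (rule out) simp
  have odd': "\<beta> (- z) = - \<beta> z" for z
  proof (cases "z \<in> ?S")
    case False
    then have "- z \<notin> ?S" by auto
    then show ?thesis using False out by simp
  qed (rule odd)
  have inj: "inj \<beta>" using p by (rule permutes_inj)
  show "\<beta> (- x) = - \<beta> x" by (rule odd')
  show "\<beta> x = x" if "\<bar>x\<bar> > int m" by (rule out) (use that in auto)
  show "\<beta> x = 0 \<longleftrightarrow> x = 0"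
    using inj_eq[OF inj, of x 0] zero by simp
  show "\<bar>\<beta> x\<bar> \<le> int m" if "\<bar>x\<bar> \<le> int m"
  proof (cases "x = 0")
    case False
    then have "x \<in> ?S" using that by auto
    then have "\<beta> x \<in> ?S" using permutes_in_image[OF p] by blast
    then show ?thesis by auto
  qed (simp add: zero)
  show "\<bar>\<beta> x\<bar> = \<bar>\<beta> y\<bar> \<longleftrightarrow> \<bar>x\<bar> = \<bar>y\<bar>"
    using inj_eq[OF inj, of x y] inj_eq[OF inj, of x "- y"]
    by (simp add: abs_eq_iff odd')
qed

text \<open>For an odd function, distinct absolute values at positive positions exclude every
  coincidence of values except between \<open>x\<close> and \<open>- x\<close>, and that one would
  force the value 0.\<close>

lemma signed_permsI:
  assumes odd: "\<And>x. \<beta> (- x) = - \<beta> x"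
    and out: "\<And>x. \<bar>x\<bar> > int m \<Longrightarrow> \<beta> x = x"
    and nz: "\<And>x. 0 < x \<Longrightarrow> x \<le> int m \<Longrightarrow> \<beta> x \<noteq> 0"
    and bound: "\<And>x. 0 < x \<Longrightarrow> x \<le> int m \<Longrightarrow> \<bar>\<beta> x\<bar> \<le> int m"
    and inj: "\<And>x y. 0 < x \<Longrightarrow> x \<le> int m \<Longrightarrow> 0 < y \<Longrightarrow> y \<le> int m \<Longrightarrow> \<bar>\<beta> x\<bar> = \<bar>\<beta> y\<bar> \<Longrightarrow> x = y"
  shows "\<beta> \<in> signed_perms m"
proof -
  let ?S = "{- int m..int m} - {0}"
  have abs_eq: "\<bar>\<beta> \<bar>x\<bar>\<bar> = \<bar>\<beta> x\<bar>" for x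
    using odd[of x] by (auto simp: abs_if)
  have nz': "\<beta> x \<noteq> 0" and bound': "\<bar>\<beta> x\<bar> \<le> int m" if "x \<in> ?S" for x
    using nz[of "\<bar>x\<bar>"] bound[of "\<bar>x\<bar>"] abs_eq[of x] that by auto
  have "inj_on \<beta> ?S"
  proof (rule inj_onI)
    fix x y assume xy: "x \<in> ?S" "y \<in> ?S" "\<beta> x = \<beta> y"
    then have "\<bar>x\<bar> = \<bar>y\<bar>"
      using inj[of "\<bar>x\<bar>" "\<bar>y\<bar>"] abs_eq[of x] abs_eq[of y] by auto
    moreover have "x \<noteq> - y"
    proof
      assume "x = - y"
      then show False using xy odd[of y] nz'[of y] by auto
    qed
    ultimately show "x = y" by (auto simp: abs_eq_iff)
  qed
  moreover have "\<beta> ` ?S \<subseteq> ?S"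
    using nz' bound' by (force simp: abs_le_iff)
  ultimately have "bij_betw \<beta> ?S ?S"
    by (simp add: bij_betw_def endo_inj_surj)
  moreover have "\<beta> x = x" if "x \<notin> ?S" for x
  proof (cases "x = 0")
    case False
    then have "\<bar>x\<bar> > int m" using that by auto
    then show ?thesis by (rule out)
  qed (use odd[of 0] in simp)
  ultimately have "\<beta> permutes ?S" by (rule bij_imp_permutes)
  then show ?thesis using odd by (simp add: signed_perms_def)
qed

section \<open>Parity of the length\<close>

text \<open>The inversions of the underlying unsigned permutation, kept as a set because exchanging
  two consecutive absolute values will add or remove a single pair.\<close>

definition abs_inversions :: "nat \<Rightarrow> (int \<Rightarrow> int) \<Rightarrow> (nat \<times> nat) set" where
  "abs_inversions m \<beta> =
     {(i, j). 1 \<le> i \<and> i < j \<and> j \<le> m \<and> \<bar>entry \<beta> i\<bar> > \<bar>entry \<beta> j\<bar>}"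

lemma finite_abs_inversions: "finite (abs_inversions m \<beta>)"
  by (rule finite_subset[of _ "{1..m} \<times> {1..m}"]) (auto simp: abs_inversions_def)

text \<open>
  For each pair \<open>i < j\<close>, exactly one of \<open>\<beta>\<^sub>i > \<beta>\<^sub>j\<close> and \<open>\<beta>\<^sub>i + \<beta>\<^sub>j < 0\<close> holds iff \<open>\<bar>\<beta>\<^sub>i\<bar> > \<bar>\<beta>\<^sub>j\<bar>\<close>.
\<close>

lemma length_B_parity:
  assumes "\<beta> \<in> signed_perms m"
  shows "(- 1 :: 'a :: comm_ring_1) ^ length_B m \<beta> =
           (- 1) ^ N1 m \<beta> * (- 1) ^ card (abs_inversions m \<beta>)"
proof -
  define A where "A = {(i, j). 1 \<le> i \<and> i < j \<and> j \<le> m \<and> entry \<beta> i > entry \<beta> j}"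
  define B where "B = {(i, j). 1 \<le> i \<and> i < j \<and> j \<le> m \<and> entry \<beta> i + entry \<beta> j < 0}"
  have fin: "finite A" "finite B"
    by (rule finite_subset[of _ "{1..m} \<times> {1..m}"]; auto simp: A_def B_def)+
  have N2: "N2 m \<beta> = card B"
  proof -
    \<comment> \<open>Listing each unordered pair in increasing order puts it in the form in which
      inversions are counted.\<close>
    have "{{i, j} | i j. i \<in> {1..m} \<and> j \<in> {1..m} \<and> i \<noteq> j \<and> entry \<beta> i + entry \<beta> j < 0}
        = (\<lambda>(i, j). {i, j}) ` B" (is "?L = ?R")
    proof
      show "?L \<subseteq> ?R"
      proof
        fix x assume "x \<in> ?L"
        then obtain i j where ij: "x = {i, j}" "i \<in> {1..m}" "j \<in> {1..m}" "i \<noteq> j"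
          "entry \<beta> i + entry \<beta> j < 0" by auto
        then have "(min i j, max i j) \<in> B" "x = {min i j, max i j}"
          by (auto simp: B_def min_def max_def add.commute)
        then show "x \<in> ?R" by force
      qed
      show "?R \<subseteq> ?L" by (fastforce simp: B_def)
    qed
    moreover have "inj_on (\<lambda>(i, j). {i, j}) B"
      by (auto simp: inj_on_def B_def doubleton_eq_iff)
    ultimately show ?thesis by (simp add: N2_def card_image)
  qed
  have "abs_inversions m \<beta> = (A - B) \<union> (B - A)"
  proof -
    have "\<bar>entry \<beta> i\<bar> > \<bar>entry \<beta> j\<bar> \<longleftrightarrow> (entry \<beta> i > entry \<beta> j) \<noteq> (entry \<beta> i + entry \<beta> j < 0)"
      if "1 \<le> i" "i < j" for i j
    proof -
      have "\<bar>entry \<beta> i\<bar> \<noteq> \<bar>entry \<beta> j\<bar>"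
        using that by (simp add: entry_def signed_perms_abs_eq_iff[OF assms])
      then show ?thesis by linarith
    qed
    then show ?thesis unfolding abs_inversions_def A_def B_def by blast
  qed
  then have "card (abs_inversions m \<beta>) = card (A - B) + card (B - A)"
    using fin by (simp add: card_Un_disjoint Diff_Int_distrib2 Int_commute disjoint_iff)
  moreover have "card A = card (A - B) + card (A \<inter> B)" "card B = card (B - A) + card (A \<inter> B)"
    using card_Int_Diff[OF fin(1), of B] card_Int_Diff[OF fin(2), of A] by (simp_all add: Int_commute)
  \<comment> \<open>The two cardinalities count the intersection twice, which does not affect the
    sign.\<close>
  ultimately have "length_B m \<beta> = N1 m \<beta> + card (abs_inversions m \<beta>) + 2 * card (A \<inter> B)"
    by (simp add: length_B_def inversions_def N2 A_def)
  then show ?thesis by (simp add: power_add power_mult)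
qed

section \<open>Exchanging the absolute values 2k - 1 and 2k\<close>

text \<open>The index k of the pair {2k - 1, 2k} containing the absolute value of \<open>x\<close>,
  with \<open>block 0 = 0\<close>. It is applied both to values and to positions.\<close>

definition block :: "int \<Rightarrow> int" where
  "block x = (\<bar>x\<bar> + 1) div 2"

lemma block_eq_iff: "k \<ge> 1 \<Longrightarrow> block x = k \<longleftrightarrow> \<bar>x\<bar> = 2 * k - 1 \<or> \<bar>x\<bar> = 2 * k"
  unfolding block_def by linarith

definition swap_block :: "int \<Rightarrow> int \<Rightarrow> int" where
  "swap_block k x =
     (if \<bar>x\<bar> = 2 * k - 1 then x + sgn x else if \<bar>x\<bar> = 2 * k then x - sgn x else x)"

lemma abs_swap_block:
  assumes "k \<ge> 1"
  shows "\<bar>swap_block k x\<bar> =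
    (if \<bar>x\<bar> = 2 * k - 1 then 2 * k else if \<bar>x\<bar> = 2 * k then 2 * k - 1 else \<bar>x\<bar>)"
  using assms by (auto simp: swap_block_def sgn_if abs_if split: if_splits)

lemma sgn_swap_block: "k \<ge> 1 \<Longrightarrow> sgn (swap_block k x) = sgn x"
  by (auto simp: swap_block_def sgn_if abs_if split: if_splits)

lemma swap_block_minus: "swap_block k (- x) = - swap_block k x"
  by (simp add: swap_block_def)

lemma swap_block_involution: "k \<ge> 1 \<Longrightarrow> swap_block k (swap_block k x) = x"
  using abs_swap_block[of k x] sgn_swap_block[of k x] mult_sgn_abs
  by (auto simp: swap_block_def sgn_if abs_if split: if_splits)

lemma block_swap_block: "k \<ge> 1 \<Longrightarrow> block (swap_block k x) = block x"
  by (auto simp: abs_swap_block block_def)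

text \<open>On nonzero integers \<open>\<prec>\<close> compares signs first and absolute values
  second. Signs are kept, and exchanging consecutive absolute values can reverse a comparison only
  between the two exchanged ones.\<close>

lemma prec_swap_block:
  assumes "k \<ge> 1" and "\<not> (block x = k \<and> block y = k \<and> sgn x = sgn y)"
  shows "swap_block k x \<prec> swap_block k y \<longleftrightarrow> x \<prec> y"
  using assms
  by (auto simp: block_eq_iff prec_def swap_block_def sgn_if abs_if split: if_splits)

lemma swap_block_comp_signed_perms:
  assumes \<beta>: "\<beta> \<in> signed_perms (2 * n)" and k: "1 \<le> k" "k \<le> int n"
  shows "swap_block k \<circ> \<beta> \<in> signed_perms (2 * n)"
proof (rule signed_permsI)
  note D = signed_permsD[OF \<beta>]
  note A = abs_swap_block[OF k(1)]
  show "(swap_block k \<circ> \<beta>) (- x) = - (swap_block k \<circ> \<beta>) x" for x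
    by (simp add: D(1) swap_block_minus)
  show "(swap_block k \<circ> \<beta>) x = x" if "\<bar>x\<bar> > int (2 * n)" for x
    using that k by (simp add: D(2) swap_block_def)
  show "(swap_block k \<circ> \<beta>) x \<noteq> 0" if "0 < x" for x
    using D(3)[of x] that sgn_swap_block[OF k(1), of "\<beta> x"] by (auto simp: sgn_0_0)
  show "\<bar>(swap_block k \<circ> \<beta>) x\<bar> \<le> int (2 * n)" if "0 < x" "x \<le> int (2 * n)" for x
    using D(4)[of x] that k by (simp add: A)
  show "x = y" if "0 < x" "0 < y" "\<bar>(swap_block k \<circ> \<beta>) x\<bar> = \<bar>(swap_block k \<circ> \<beta>) y\<bar>" for x y
    using that D(5)[of x y] by (auto simp: A split: if_splits)
qed

text \<open>A preimage of \<open>v\<close> may be negative, so its absolute value is the position;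
  this changes the entry only in sign. A preimage beyond \<open>m\<close> would be fixed, against
  the bound on \<open>v\<close>.\<close>

lemma signed_perms_ex_abs:
  assumes \<beta>: "\<beta> \<in> signed_perms m" and v: "0 < v" "v \<le> int m"
  shows "\<exists>p \<in> {1..m}. \<bar>entry \<beta> p\<bar> = v"
proof -
  have "\<beta> permutes ({- int m..int m} - {0})" using \<beta> by (simp add: signed_perms_def)
  then obtain x where x: "\<beta> x = v" by (metis permutes_surj surjD)
  have "x \<noteq> 0" using x v signed_perms_eq_0_iff[OF \<beta>, of x] by auto
  moreover have "\<bar>x\<bar> \<le> int m"
    using x v signed_perms_outside[OF \<beta>, of x] by linarith
  moreover have "\<bar>\<beta> \<bar>x\<bar>\<bar> = v"
    using x v signed_perms_abs_eq_iff[OF \<beta>, of "\<bar>x\<bar>" x] by simp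
  ultimately show ?thesis
    by (intro bexI[of _ "nat \<bar>x\<bar>"]) (auto simp: entry_def)
qed

text \<open>Nothing lies strictly between 2k - 1 and 2k, so both compare alike with every other
  absolute value; only the order at \<open>p\<close> and \<open>q\<close> changes.\<close>

lemma abs_inversions_swap_block_insert:
  assumes \<beta>: "\<beta> \<in> signed_perms m" and k: "1 \<le> k"
    and p: "p \<in> {1..m}" "\<bar>entry \<beta> p\<bar> = 2 * k - 1" and q: "q \<in> {1..m}" "\<bar>entry \<beta> q\<bar> = 2 * k"
    and "p < q"
  shows "abs_inversions m (swap_block k \<circ> \<beta>) = insert (p, q) (abs_inversions m \<beta>)"
    and "(p, q) \<notin> abs_inversions m \<beta>"
proof -
  have eq: "\<bar>entry \<beta> i\<bar> = \<bar>entry \<beta> j\<bar> \<longleftrightarrow> i = j" for i j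
    by (simp add: entry_def signed_perms_abs_eq_iff[OF \<beta>])
  have P: "\<bar>entry \<beta> i\<bar> = 2 * k - 1 \<longleftrightarrow> i = p" and Q: "\<bar>entry \<beta> i\<bar> = 2 * k \<longleftrightarrow> i = q" for i
    using eq[of i p] eq[of i q] p q by auto
  have E: "\<bar>entry (swap_block k \<circ> \<beta>) i\<bar> =
      (if i = p then 2 * k else if i = q then 2 * k - 1 else \<bar>entry \<beta> i\<bar>)" for i
    using P[of i] Q[of i] by (simp add: entry_def abs_swap_block[OF k])
  have "\<bar>entry (swap_block k \<circ> \<beta>) i\<bar> > \<bar>entry (swap_block k \<circ> \<beta>) j\<bar> \<longleftrightarrow>
      (i, j) = (p, q) \<or> \<bar>entry \<beta> i\<bar> > \<bar>entry \<beta> j\<bar>" if "i < j" for i j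
    using that \<open>p < q\<close> P[of i] P[of j] Q[of i] Q[of j] p(2) q(2) unfolding E
    by (auto split: if_splits)
  then show "abs_inversions m (swap_block k \<circ> \<beta>) = insert (p, q) (abs_inversions m \<beta>)"
    using p q \<open>p < q\<close> by (auto simp: abs_inversions_def)
  show "(p, q) \<notin> abs_inversions m \<beta>" using p q by (simp add: abs_inversions_def)
qed

lemma abs_inversions_swap_block:
  assumes \<beta>: "\<beta> \<in> signed_perms (2 * n)" and k: "1 \<le> k" "k \<le> int n"
  shows "(- 1 :: 'a :: comm_ring_1) ^ card (abs_inversions (2 * n) (swap_block k \<circ> \<beta>)) =
           - ((- 1) ^ card (abs_inversions (2 * n) \<beta>))"
proof -
  obtain p where p: "p \<in> {1..2 * n}" "\<bar>entry \<beta> p\<bar> = 2 * k - 1"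
    using signed_perms_ex_abs[OF \<beta>, of "2 * k - 1"] k by auto
  obtain q where q: "q \<in> {1..2 * n}" "\<bar>entry \<beta> q\<bar> = 2 * k"
    using signed_perms_ex_abs[OF \<beta>, of "2 * k"] k by auto
  have "p \<noteq> q" using p q by auto
  then consider "p < q" | "q < p" by linarith
  then show ?thesis
  proof cases
    case 1
    show ?thesis
      using abs_inversions_swap_block_insert[OF \<beta> k(1) p q 1]
      by (simp add: finite_abs_inversions)
  next
    \<comment> \<open>In absolute value \<open>?\<gamma>\<close> has \<open>2 * k - 1\<close> at
      \<open>q\<close> and \<open>2 * k\<close> at \<open>p\<close>, now in increasing order, and
      exchanging again gives \<open>\<beta>\<close>. So the insertion lemma is applied to
      \<open>?\<gamma>\<close>.\<close>
    case 2
    let ?\<gamma> = "swap_block k \<circ> \<beta>"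
    have "swap_block k \<circ> ?\<gamma> = \<beta>" by (simp add: fun_eq_iff swap_block_involution[OF k(1)])
    moreover have "\<bar>entry ?\<gamma> q\<bar> = 2 * k - 1" "\<bar>entry ?\<gamma> p\<bar> = 2 * k"
      using p q by (auto simp: entry_def abs_swap_block[OF k(1)])
    ultimately show ?thesis
      using abs_inversions_swap_block_insert[OF swap_block_comp_signed_perms[OF \<beta> k] k(1) q(1) _ p(1) _ 2]
      by (simp add: finite_abs_inversions)
  qed
qed

section \<open>Cancellation of the permutations that are not aligned\<close>

text \<open>The case excluded in \<open>prec_swap_block\<close>, occurring at adjacent positions:
  only there can the exchange change a descent.\<close>

definition aligned :: "nat \<Rightarrow> int \<Rightarrow> (int \<Rightarrow> int) \<Rightarrow> bool" where
  "aligned m k \<beta> \<longleftrightarrow> (\<exists>i \<in> {1..<m}. block (entry \<beta> i) = k \<and> block (entry \<beta> (i + 1)) = k \<and>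
     sgn (entry \<beta> i) = sgn (entry \<beta> (i + 1)))"

text \<open>Alignment depends only on blocks and signs. This is what allows the pairs to be treated
  one after another.\<close>

lemma aligned_swap_block:
  "j \<ge> 1 \<Longrightarrow> aligned m k (swap_block j \<circ> \<beta>) = aligned m k \<beta>"
  by (simp add: aligned_def entry_def block_swap_block sgn_swap_block)

lemma N1_swap_block:
  assumes "k \<ge> 1"
  shows "N1 m (swap_block k \<circ> \<beta>) = N1 m \<beta>"
proof -
  have "swap_block k x < 0 \<longleftrightarrow> x < 0" for x
    using sgn_swap_block[OF assms, of x] by (metis sgn_less)
  then show ?thesis by (simp add: N1_def entry_def)
qed

lemma fmaj_swap_block:
  assumes "k \<ge> 1" and "\<not> aligned m k \<beta>"
  shows "fmaj m (swap_block k \<circ> \<beta>) = fmaj m \<beta>"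
proof -
  have "Des m (swap_block k \<circ> \<beta>) = Des m \<beta>"
    using assms prec_swap_block[OF assms(1)] unfolding Des_def aligned_def entry_def o_def
    by (intro Collect_cong conj_cong refl) metis
  then show ?thesis by (simp add: fmaj_def maj_def N1_swap_block[OF assms(1)])
qed

definition weight :: "nat \<Rightarrow> (int \<Rightarrow> int) \<Rightarrow> int poly" where
  "weight m \<beta> = (- 1) ^ length_B m \<beta> * monom 1 (fmaj m \<beta>)"

lemma weight_swap_block:
  assumes \<beta>: "\<beta> \<in> signed_perms (2 * n)" and k: "1 \<le> k" "k \<le> int n"
    and "\<not> aligned (2 * n) k \<beta>"
  shows "weight (2 * n) (swap_block k \<circ> \<beta>) = - weight (2 * n) \<beta>"
  using assms swap_block_comp_signed_perms[OF \<beta> k]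
  by (simp add: weight_def length_B_parity N1_swap_block fmaj_swap_block abs_inversions_swap_block)

text \<open>Induction on \<open>K\<close>: among the permutations aligned for all of
  \<open>K\<close> but not for the new \<open>k\<close>, the exchange for \<open>k\<close> is a
  sign-reversing involution.\<close>

lemma sum_weight_aligned:
  assumes "finite K" and "K \<subseteq> {1..int n}"
  shows "(\<Sum>\<beta> \<in> signed_perms (2 * n). weight (2 * n) \<beta>) =
         (\<Sum>\<beta> | \<beta> \<in> signed_perms (2 * n) \<and> (\<forall>k \<in> K. aligned (2 * n) k \<beta>). weight (2 * n) \<beta>)"
  using assms
proof (induction K rule: finite_induct)
  case empty
  then show ?case by simp
next
  case (insert k K)
  then have k: "1 \<le> k" "k \<le> int n" by auto
  let ?P = "\<lambda>K. {\<beta> \<in> signed_perms (2 * n). \<forall>k \<in> K. aligned (2 * n) k \<beta>}"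
  let ?N = "{\<beta> \<in> ?P K. \<not> aligned (2 * n) k \<beta>}"
  have fin: "finite (?P K)" using finite_signed_perms[of "2 * n"] by simp
  have "sum (weight (2 * n)) ?N = (\<Sum>\<beta> \<in> ?N. - weight (2 * n) \<beta>)"
    by (rule sum.reindex_bij_witness[of _ "(\<circ>) (swap_block k)" "(\<circ>) (swap_block k)"])
      (use k in \<open>auto simp: fun_eq_iff swap_block_involution aligned_swap_block
         swap_block_comp_signed_perms weight_swap_block\<close>)
  \<comment> \<open>The sum equals its own negative, so it vanishes over the integers.\<close>
  then have "sum (weight (2 * n)) ?N = 0" by (simp add: sum_negf)
  moreover have "?P K = ?P (insert k K) \<union> ?N" "?P (insert k K) \<inter> ?N = {}" by auto
  ultimately have "sum (weight (2 * n)) (?P K) = sum (weight (2 * n)) (?P (insert k K))"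
    using fin by (metis (no_types, lifting) add.right_neutral finite_Un sum.union_disjoint)
  then show ?case using insert by simp
qed


text \<open>
  By induction on \<open>k\<close>: the partner of the entry at \<open>2k - 1\<close> is adjacent to it, and position \<open>2k - 2\<close>
  is already matched with \<open>2k - 3\<close>.
\<close>

lemma aligned_iff_paired:
  assumes \<beta>: "\<beta> \<in> signed_perms (2 * n)"
  shows "(\<forall>v \<in> {1..int n}. aligned (2 * n) v \<beta>) \<longleftrightarrow>
    (\<forall>k \<in> {1..n}. block (entry \<beta> (2 * k - 1)) = block (entry \<beta> (2 * k)) \<and>
       sgn (entry \<beta> (2 * k - 1)) = sgn (entry \<beta> (2 * k)))" (is "?L \<longleftrightarrow> (\<forall>k \<in> _. ?Q k)")
proof
  assume ?L
  have eq: "\<bar>entry \<beta> i\<bar> = \<bar>entry \<beta> j\<bar> \<longleftrightarrow> i = j" for i j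
    by (simp add: entry_def signed_perms_abs_eq_iff[OF \<beta>])
  have "?Q k" if "1 \<le> k" "k \<le> n" for k
    using that
  proof (induction k rule: less_induct)
    case (less k)
    let ?p = "2 * k - 1"
    define v where "v = block (entry \<beta> ?p)"
    have "\<bar>entry \<beta> ?p\<bar> \<le> 2 * int n" "entry \<beta> ?p \<noteq> 0"
      using less.prems signed_perms_bound[OF \<beta>, of "int ?p"] signed_perms_eq_0_iff[OF \<beta>, of "int ?p"]
      by (auto simp: entry_def)
    then have v: "v \<in> {1..int n}" by (auto simp: v_def block_def)
    then obtain i where i: "i \<in> {1..<2 * n}" "block (entry \<beta> i) = v" "block (entry \<beta> (i + 1)) = v"
      "sgn (entry \<beta> i) = sgn (entry \<beta> (i + 1))"
      using \<open>?L\<close> unfolding aligned_def by blast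
    \<comment> \<open>A block has two absolute values, each at one position, so \<open>i\<close> and
      \<open>i + 1\<close> exhaust it.\<close>
    have pos: "j = i \<or> j = i + 1" if "block (entry \<beta> j) = v" for j
      using that i(2,3) v eq[of j i] eq[of j "i + 1"] eq[of i "i + 1"] by (auto simp: block_eq_iff)
    have "?p = i \<or> ?p = i + 1" by (rule pos) (simp add: v_def)
    then show ?case
    proof
      assume "?p = i"
      then have "2 * k = i + 1" using less.prems by linarith
      then show ?thesis using i \<open>?p = i\<close> by simp
    next
      \<comment> \<open>This case is contradictory: \<open>i - 1\<close> would be a third position
        with block \<open>v\<close>.\<close>
      assume *: "?p = i + 1"
      then have k: "1 \<le> k - 1" "k - 1 < k" "2 * (k - 1) = i" "2 * (k - 1) - 1 < i" using less.prems i by auto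
      then have "block (entry \<beta> (2 * (k - 1) - 1)) = v"
        using less.IH[of "k - 1"] less.prems i by auto
      then show ?thesis using pos k by fastforce
    qed
  qed
  then show "\<forall>k \<in> {1..n}. ?Q k" by simp
next
  assume R: "\<forall>k \<in> {1..n}. ?Q k"
  show ?L
  proof
    fix v assume v: "v \<in> {1..int n}"
    \<comment> \<open>The position of the absolute value \<open>2 * v\<close> reveals which position
      pair carries block \<open>v\<close>.\<close>
    then obtain p where p: "p \<in> {1..2 * n}" "\<bar>entry \<beta> p\<bar> = 2 * v"
      using signed_perms_ex_abs[OF \<beta>, of "2 * v"] by auto
    define k where "k = (p + 1) div 2"
    have k: "k \<in> {1..n}" "p = 2 * k - 1 \<or> p = 2 * k" using p by (auto simp: k_def)
    have "block (entry \<beta> p) = v" using p(2) v by (auto simp: block_eq_iff)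
    then have "block (entry \<beta> (2 * k - 1)) = v" "block (entry \<beta> (2 * k)) = v" using R k by auto
    moreover have "2 * k - 1 \<in> {1..<2 * n}" "2 * k - 1 + 1 = 2 * k" using k by auto
    ultimately show "aligned (2 * n) v \<beta>"
      using R k unfolding aligned_def by (metis (no_types, lifting))
  qed
qed

section \<open>Doubling a signed permutation, and the inverse construction\<close>

text \<open>
  \<open>double \<gamma> E\<close> has \<open>2\<bar>\<gamma>\<^sub>k\<bar> - 1\<close> and \<open>2\<bar>\<gamma>\<^sub>k\<bar>\<close>, with the sign of \<open>\<gamma>\<^sub>k\<close>, at the positions \<open>2k - 1\<close> and \<open>2k\<close>,
  the larger absolute value first iff \<open>k \<in> E\<close>.
\<close>

definition double :: "(int \<Rightarrow> int) \<Rightarrow> nat set \<Rightarrow> int \<Rightarrow> int" where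
  "double \<gamma> E x = sgn x * sgn (\<gamma> (block x)) *
     (2 * \<bar>\<gamma> (block x)\<bar> - of_bool (odd x \<noteq> (nat (block x) \<in> E)))"

text \<open>Reading position \<open>2 * x\<close> suffices: when the entries of a position pair
  share block and sign, the other position gives the same result.\<close>

definition halve :: "(int \<Rightarrow> int) \<Rightarrow> int \<Rightarrow> int" where
  "halve \<beta> x = sgn (\<beta> (2 * x)) * block (\<beta> (2 * x))"

text \<open>Recovers \<open>E\<close> from \<open>double \<gamma> E\<close>. When paired entries
  have equal signs, comparing absolute values is comparing under \<open>\<prec>\<close>, so these
  are the descents at odd positions.\<close>

definition pair_descents :: "nat \<Rightarrow> (int \<Rightarrow> int) \<Rightarrow> nat set" where
  "pair_descents n \<beta> = {k \<in> {1..n}. \<bar>entry \<beta> (2 * k - 1)\<bar> > \<bar>entry \<beta> (2 * k)\<bar>}"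

lemma block_minus [simp]: "block (- x) = block x"
  by (simp add: block_def)

lemma block_double_arg [simp]: "block (2 * x) = \<bar>x\<bar>"
  by (simp add: block_def abs_mult)

lemma entry_double:
  assumes "k \<ge> 1"
  shows "entry (double \<gamma> E) (2 * k - 1) =
           sgn (entry \<gamma> k) * (2 * \<bar>entry \<gamma> k\<bar> - of_bool (k \<notin> E))"
    and "entry (double \<gamma> E) (2 * k) =
           sgn (entry \<gamma> k) * (2 * \<bar>entry \<gamma> k\<bar> - of_bool (k \<in> E))"
proof -
  have "block (2 * int k - 1) = int k" using assms by (simp add: block_eq_iff)
  then show "entry (double \<gamma> E) (2 * k - 1) =
           sgn (entry \<gamma> k) * (2 * \<bar>entry \<gamma> k\<bar> - of_bool (k \<notin> E))"
    using assms by (simp add: entry_def double_def)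
  show "entry (double \<gamma> E) (2 * k) =
           sgn (entry \<gamma> k) * (2 * \<bar>entry \<gamma> k\<bar> - of_bool (k \<in> E))"
    using assms by (simp add: entry_def double_def)
qed

lemma abs_double:
  assumes "\<gamma> (block x) \<noteq> 0" "x \<noteq> 0"
  shows "\<bar>double \<gamma> E x\<bar> = 2 * \<bar>\<gamma> (block x)\<bar> - of_bool (odd x \<noteq> (nat (block x) \<in> E))"
  using assms by (auto simp: double_def abs_mult sgn_if)

text \<open>Injectivity: an absolute value \<open>2 * a - d\<close> with d = 0 or 1 determines both
  a and d; the first yields the block of the position, the second its parity.\<close>

lemma double_signed_perms:
  assumes \<gamma>: "\<gamma> \<in> signed_perms n" and E: "E \<subseteq> {1..n}"
  shows "double \<gamma> E \<in> signed_perms (2 * n)"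
proof (rule signed_permsI)
  have nz: "\<gamma> (block x) \<noteq> 0" if "x \<noteq> 0" for x
    using that by (auto simp: signed_perms_eq_0_iff[OF \<gamma>] block_def)
  show "double \<gamma> E (- x) = - double \<gamma> E x" for x
    by (simp add: double_def)
  \<comment> \<open>Beyond \<open>2 * n\<close> the block is fixed by \<open>\<gamma>\<close> and is
    not in \<open>E\<close>, so \<open>double\<close> rebuilds \<open>x\<close> from its sign, block
    and parity.\<close>
  show "double \<gamma> E x = x" if "\<bar>x\<bar> > int (2 * n)" for x
  proof -
    have b: "block x > int n" using that by (auto simp: block_def)
    then have "nat (block x) > n" by simp
    then have "nat (block x) \<notin> E" using E by auto
    moreover have "\<gamma> (block x) = block x"
      using b signed_perms_outside[OF \<gamma>, of "block x"] by auto
    ultimately have "double \<gamma> E x = sgn x * (2 * block x - of_bool (odd x))"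
      using b by (simp add: double_def)
    also have "2 * block x - of_bool (odd x) = \<bar>x\<bar>"
    proof -
      have "2 * ((a + 1) div 2) - of_bool (odd a) = a" for a :: int
        by (cases "odd a") (auto elim!: oddE evenE)
      from this[of "\<bar>x\<bar>"] show ?thesis by (simp add: block_def)
    qed
    finally show ?thesis by (simp add: sgn_mult_abs)
  qed
  show "double \<gamma> E x \<noteq> 0" if "0 < x" for x
    using abs_double[of \<gamma> x E] nz[of x] that by (auto simp: of_bool_def split: if_splits)
  show "\<bar>double \<gamma> E x\<bar> \<le> int (2 * n)" if "0 < x" "x \<le> int (2 * n)" for x
  proof -
    have "\<bar>\<gamma> (block x)\<bar> \<le> int n"
      by (rule signed_perms_bound[OF \<gamma>]) (use that in \<open>auto simp: block_def\<close>)
    then show ?thesis using abs_double[of \<gamma> x E] nz[of x] that by simp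
  qed
  show "x = y" if xy: "0 < x" "0 < y" "\<bar>double \<gamma> E x\<bar> = \<bar>double \<gamma> E y\<bar>" for x y
  proof -
    have *: "2 * \<bar>\<gamma> (block x)\<bar> - of_bool (odd x \<noteq> (nat (block x) \<in> E)) =
        2 * \<bar>\<gamma> (block y)\<bar> - of_bool (odd y \<noteq> (nat (block y) \<in> E))"
      using xy nz[of x] nz[of y] by (simp add: abs_double)
    have half: "a = b" if "2 * a - of_bool p = 2 * b - of_bool q" for a b :: int and p q
      using that by (auto simp: of_bool_def split: if_splits)
    have "\<bar>\<gamma> (block x)\<bar> = \<bar>\<gamma> (block y)\<bar>" using * by (rule half)
    then have b: "block x = block y"
      using xy by (simp add: signed_perms_abs_eq_iff[OF \<gamma>] block_def)
    with * have "odd x = odd y" by (auto simp: of_bool_def split: if_splits)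
    with b xy show ?thesis by (auto simp: block_def elim!: oddE evenE)
  qed
qed

text \<open>\<open>block\<close> undoes the subtraction of 0 or 1, whatever \<open>E\<close> is, and
  oddness of \<open>\<gamma>\<close> absorbs the factor \<open>sgn x\<close>.\<close>

lemma halve_double:
  assumes \<gamma>: "\<gamma> \<in> signed_perms n"
  shows "halve (double \<gamma> E) = \<gamma>"
proof
  fix x
  show "halve (double \<gamma> E) x = \<gamma> x"
  proof (cases "x = 0")
    case True
    then show ?thesis
      using signed_perms_eq_0_iff[OF \<gamma>, of 0] by (simp add: halve_def double_def)
  next
    case False
    let ?y = "double \<gamma> E (2 * x)"
    have nz: "\<gamma> \<bar>x\<bar> \<noteq> 0" using False signed_perms_eq_0_iff[OF \<gamma>] by simp
    then have "block ?y = \<bar>\<gamma> \<bar>x\<bar>\<bar>"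
      using abs_double[of \<gamma> "2 * x" E] False by (simp add: block_def[of ?y])
    moreover have "sgn ?y = sgn x * sgn (\<gamma> \<bar>x\<bar>)"
      using nz by (auto simp: double_def sgn_mult sgn_if)
    ultimately have "halve (double \<gamma> E) x = sgn x * \<gamma> \<bar>x\<bar>"
      by (simp add: halve_def mult.assoc sgn_mult_abs)
    then show ?thesis
      using signed_perms_minus[OF \<gamma>, of x] False by (simp add: sgn_if abs_if)
  qed
qed

lemma pair_descents_double:
  assumes \<gamma>: "\<gamma> \<in> signed_perms n" and E: "E \<subseteq> {1..n}"
  shows "pair_descents n (double \<gamma> E) = E"
proof -
  have "\<bar>entry (double \<gamma> E) (2 * k - 1)\<bar> > \<bar>entry (double \<gamma> E) (2 * k)\<bar> \<longleftrightarrow> k \<in> E" if "k \<ge> 1" for k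
  proof -
    have "entry \<gamma> k \<noteq> 0" using that by (simp add: entry_def signed_perms_eq_0_iff[OF \<gamma>])
    then show ?thesis using entry_double[OF that, of \<gamma> E] by (simp add: abs_mult)
  qed
  then show ?thesis using E by (auto simp: pair_descents_def)
qed


lemma signed_perms_eqI:
  assumes "\<beta> \<in> signed_perms m" "\<beta>' \<in> signed_perms m"
    and eq: "\<And>i. i \<in> {1..m} \<Longrightarrow> entry \<beta> i = entry \<beta>' i"
  shows "\<beta> = \<beta>'"
proof
  fix x
  note minus = signed_perms_minus[OF assms(1)] signed_perms_minus[OF assms(2)]
  note out = signed_perms_outside[OF assms(1)] signed_perms_outside[OF assms(2)]
  have pos: "\<beta> y = \<beta>' y" if "y > 0" for y
    using eq[of "nat y"] out[of y] that by (cases "y \<le> int m") (auto simp: entry_def Suc_le_eq)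
  show "\<beta> x = \<beta>' x"
    using pos[of x] pos[of "- x"] minus[of x] minus[of 0] by (cases x "0 :: int" rule: linorder_cases) auto
qed

context
  fixes n :: nat and \<beta> :: "int \<Rightarrow> int"
  assumes \<beta>: "\<beta> \<in> signed_perms (2 * n)"
    and paired: "\<And>k. k \<in> {1..n} \<Longrightarrow> block (entry \<beta> (2 * k - 1)) = block (entry \<beta> (2 * k)) \<and>
      sgn (entry \<beta> (2 * k - 1)) = sgn (entry \<beta> (2 * k))"
begin

text \<open>Two different absolute values in one block must be its two members, in one order or the
  other.\<close>

lemma abs_entry_pair:
  assumes "k \<in> {1..n}"
  defines "v \<equiv> block (entry \<beta> (2 * k))"
  shows "v \<ge> 1"
    and "\<bar>entry \<beta> (2 * k - 1)\<bar> = 2 * v - 1 \<and> \<bar>entry \<beta> (2 * k)\<bar> = 2 * v \<or>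
         \<bar>entry \<beta> (2 * k - 1)\<bar> = 2 * v \<and> \<bar>entry \<beta> (2 * k)\<bar> = 2 * v - 1"
proof -
  have "entry \<beta> (2 * k) \<noteq> 0"
    using assms(1) by (simp add: entry_def signed_perms_eq_0_iff[OF \<beta>])
  then show v: "v \<ge> 1" by (auto simp: v_def block_def)
  have "2 * k - 1 \<noteq> 2 * k" using assms(1) by auto
  then have "\<bar>entry \<beta> (2 * k - 1)\<bar> \<noteq> \<bar>entry \<beta> (2 * k)\<bar>"
    by (simp only: entry_def signed_perms_abs_eq_iff[OF \<beta>] abs_of_nat of_nat_eq_iff not_False_eq_True)
  moreover have "block (entry \<beta> (2 * k - 1)) = v" "block (entry \<beta> (2 * k)) = v"
    using paired[OF assms(1)] by (simp_all add: v_def)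
  ultimately show "\<bar>entry \<beta> (2 * k - 1)\<bar> = 2 * v - 1 \<and> \<bar>entry \<beta> (2 * k)\<bar> = 2 * v \<or>
         \<bar>entry \<beta> (2 * k - 1)\<bar> = 2 * v \<and> \<bar>entry \<beta> (2 * k)\<bar> = 2 * v - 1"
    unfolding block_eq_iff[OF v] by linarith
qed

lemma entry_halve: "entry (halve \<beta>) k = sgn (entry \<beta> (2 * k)) * block (entry \<beta> (2 * k))"
  by (simp add: entry_def halve_def)

lemma halve_signed_perms: "halve \<beta> \<in> signed_perms n"
proof (rule signed_permsI)
  note D = signed_permsD[OF \<beta>]
  show "halve \<beta> (- x) = - halve \<beta> x" for x
    using D(1)[of "2 * x"] by (simp add: halve_def)
  show "halve \<beta> x = x" if "\<bar>x\<bar> > int n" for x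
    using D(2)[of "2 * x"] that by (simp add: halve_def sgn_mult sgn_mult_abs)
  have abs_halve: "\<bar>halve \<beta> x\<bar> = block (\<beta> (2 * x))" if "0 < x" for x
    using D(3)[of "2 * x"] that by (simp add: halve_def abs_mult sgn_if block_def)
  show "halve \<beta> x \<noteq> 0" if "0 < x" for x
    using abs_halve[OF that] D(3)[of "2 * x"] that by (auto simp: block_def)
  show "\<bar>halve \<beta> x\<bar> \<le> int n" if "0 < x" "x \<le> int n" for x
    using abs_halve[of x] D(4)[of "2 * x"] that by (auto simp: block_def)
  show "x = y" if xy: "0 < x" "x \<le> int n" "0 < y" "y \<le> int n" "\<bar>halve \<beta> x\<bar> = \<bar>halve \<beta> y\<bar>" for x y
  proof -
    define k l where "k = nat x" and "l = nat y"
    have kl: "k \<in> {1..n}" "l \<in> {1..n}" "x = int k" "y = int l" using xy by (auto simp: k_def l_def)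
    then have "block (entry \<beta> (2 * k)) = block (entry \<beta> (2 * l))"
      using xy abs_halve[of x] abs_halve[of y] by (simp add: entry_def)
    \<comment> \<open>The block has only the absolute values found at \<open>2 * l - 1\<close> and
      \<open>2 * l\<close>, so \<open>2 * k\<close> is one of these positions, and by parity the
      second.\<close>
    then have "\<bar>entry \<beta> (2 * k)\<bar> = \<bar>entry \<beta> (2 * l)\<bar> \<or> \<bar>entry \<beta> (2 * k)\<bar> = \<bar>entry \<beta> (2 * l - 1)\<bar>"
      using abs_entry_pair[OF kl(1)] abs_entry_pair[OF kl(2)] by auto
    then have "2 * k = 2 * l \<or> 2 * k = 2 * l - 1"
      unfolding entry_def D(5) by (simp only: abs_of_nat of_nat_eq_iff)
    then show "x = y" using kl by auto
  qed
qed

lemma double_halve: "double (halve \<beta>) (pair_descents n \<beta>) = \<beta>"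
proof (rule signed_perms_eqI)
  let ?E = "pair_descents n \<beta>"
  show "double (halve \<beta>) ?E \<in> signed_perms (2 * n)"
    by (rule double_signed_perms[OF halve_signed_perms]) (auto simp: pair_descents_def)
  show "\<beta> \<in> signed_perms (2 * n)" by (rule \<beta>)
  have *: "entry (double (halve \<beta>) ?E) (2 * k - 1) = entry \<beta> (2 * k - 1)"
    "entry (double (halve \<beta>) ?E) (2 * k) = entry \<beta> (2 * k)" if k: "k \<in> {1..n}" for k
  proof -
    define v where "v = block (entry \<beta> (2 * k))"
    define s where "s = sgn (entry \<beta> (2 * k))"
    have v: "v \<ge> 1" using abs_entry_pair(1)[OF k] by (simp add: v_def)
    then have "entry \<beta> (2 * k) \<noteq> 0" by (auto simp: v_def block_def)
    then have h: "sgn (entry (halve \<beta>) k) = s" "\<bar>entry (halve \<beta>) k\<bar> = v"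
      using v unfolding entry_halve v_def[symmetric] s_def[symmetric]
      by (auto simp: s_def sgn_mult abs_mult sgn_if)
    \<comment> \<open>Membership in \<open>?E\<close> tells which arrangement of
      \<open>abs_entry_pair\<close> occurs, which matches the formulas of
      \<open>entry_double\<close>.\<close>
    have "k \<in> ?E \<longleftrightarrow> \<bar>entry \<beta> (2 * k - 1)\<bar> > \<bar>entry \<beta> (2 * k)\<bar>"
      using k by (simp add: pair_descents_def)
    then have "\<bar>entry \<beta> (2 * k - 1)\<bar> = 2 * v - of_bool (k \<notin> ?E)"
      "\<bar>entry \<beta> (2 * k)\<bar> = 2 * v - of_bool (k \<in> ?E)"
      using abs_entry_pair(2)[OF k] by (auto simp: v_def)
    moreover have "entry \<beta> (2 * k - 1) = s * \<bar>entry \<beta> (2 * k - 1)\<bar>"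
      "entry \<beta> (2 * k) = s * \<bar>entry \<beta> (2 * k)\<bar>"
      using paired[OF k] by (metis s_def sgn_mult_abs)+
    ultimately show "entry (double (halve \<beta>) ?E) (2 * k - 1) = entry \<beta> (2 * k - 1)"
      "entry (double (halve \<beta>) ?E) (2 * k) = entry \<beta> (2 * k)"
      using k entry_double[of k "halve \<beta>" ?E] by (simp_all only: h atLeastAtMost_iff)
  qed
  show "entry (double (halve \<beta>) ?E) i = entry \<beta> i" if i: "i \<in> {1..2 * n}" for i
  proof -
    define k where "k = (i + 1) div 2"
    have "k \<in> {1..n}" "i = 2 * k - 1 \<or> i = 2 * k" using i by (auto simp: k_def)
    then show ?thesis using * by blast
  qed
qed

end

section \<open>The statistics of a doubled permutation\<close>

text \<open>The statistics are written as sums over all positions so that they can be evaluated pair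
  by pair.\<close>

lemma sum_pairs:
  fixes f :: "nat \<Rightarrow> 'a :: comm_monoid_add"
  shows "(\<Sum>i = 1..2 * n. f i) = (\<Sum>k = 1..n. f (2 * k - 1) + f (2 * k))"
  by (induction n) (simp_all add: add_ac)

lemma N1_eq_sum: "N1 m \<beta> = (\<Sum>i = 1..m. of_bool (entry \<beta> i < 0))"
  by (simp add: N1_def Int_def)

text \<open>A signed permutation fixes \<open>m + 1\<close>, so position \<open>m\<close> contributes no descent.\<close>

lemma maj_eq_sum:
  assumes \<beta>: "\<beta> \<in> signed_perms m"
  shows "maj m \<beta> = (\<Sum>i = 1..m. of_bool (entry \<beta> (i + 1) \<prec> entry \<beta> i) * i)"
proof -
  have "\<not> entry \<beta> (m + 1) \<prec> entry \<beta> m"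
    using signed_perms_outside[OF \<beta>, of "int m + 1"] signed_perms_bound[OF \<beta>, of "int m"]
    by (auto simp: entry_def prec_def add.commute)
  then have "Des m \<beta> = {i \<in> {1..m}. entry \<beta> (i + 1) \<prec> entry \<beta> i}"
    by (auto simp: Des_def order.order_iff_strict)
  then have "maj m \<beta> = (\<Sum>i \<in> {i \<in> {1..m}. entry \<beta> (i + 1) \<prec> entry \<beta> i}. i)"
    by (simp only: maj_def)
  also have "\<dots> = (\<Sum>i = 1..m. if entry \<beta> (i + 1) \<prec> entry \<beta> i then i else 0)"
    by (rule sum.inter_filter) simp
  also have "\<dots> = (\<Sum>i = 1..m. of_bool (entry \<beta> (i + 1) \<prec> entry \<beta> i) * i)"
    by (rule sum.cong) auto
  finally show ?thesis .
qed

lemma card_abs_inversions_eq_sum: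
  "card (abs_inversions m \<beta>) =
     (\<Sum>i = 1..m. \<Sum>j = 1..m. of_bool (i < j \<and> \<bar>entry \<beta> i\<bar> > \<bar>entry \<beta> j\<bar>))"
proof -
  have "abs_inversions m \<beta> = {1..m} \<times> {1..m} \<inter>
      {p. fst p < snd p \<and> \<bar>entry \<beta> (fst p)\<bar> > \<bar>entry \<beta> (snd p)\<bar>}"
    by (auto simp: abs_inversions_def)
  then show ?thesis
    unfolding sum.cartesian_product case_prod_unfold
    by (simp only: sum_of_bool_eq finite_SigmaI finite_atLeastAtMost of_nat_id)
qed

context
  fixes n :: nat and \<gamma> :: "int \<Rightarrow> int" and E :: "nat set"
  assumes \<gamma>: "\<gamma> \<in> signed_perms n" and E: "E \<subseteq> {1..n}"
begin

lemma N1_double: "N1 (2 * n) (double \<gamma> E) = 2 * N1 n \<gamma>"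
proof -
  have "entry (double \<gamma> E) (2 * k - 1) < 0 \<longleftrightarrow> entry \<gamma> k < 0"
    "entry (double \<gamma> E) (2 * k) < 0 \<longleftrightarrow> entry \<gamma> k < 0" if "k \<in> {1..n}" for k
    using that entry_double[of k \<gamma> E] by (auto simp: sgn_if abs_if of_bool_def split: if_splits)
  then show ?thesis
    unfolding N1_eq_sum sum_pairs sum_distrib_left by (intro sum.cong) simp_all
qed

text \<open>Position \<open>2 * k - 1\<close> is a descent iff \<open>k \<in> E\<close>, and
  position \<open>2 * k\<close> is one iff \<open>k\<close> is a descent of
  \<open>\<gamma>\<close>.\<close>

lemma maj_double: "maj (2 * n) (double \<gamma> E) = 2 * maj n \<gamma> + (\<Sum>k \<in> E. 2 * k - 1)"
proof -
  let ?\<beta> = "double \<gamma> E"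
  have nz: "entry \<gamma> k \<noteq> 0" if "k \<ge> 1" for k
    using that by (simp add: entry_def signed_perms_eq_0_iff[OF \<gamma>])
  have within: "entry ?\<beta> (2 * k - 1 + 1) \<prec> entry ?\<beta> (2 * k - 1) \<longleftrightarrow> k \<in> E" if "k \<in> {1..n}" for k
  proof -
    have "2 * k - 1 + 1 = 2 * k" "k \<ge> 1" using that by auto
    then show ?thesis
      using nz[of k] entry_double[of k \<gamma> E] by (simp add: prec_def sgn_if)
  qed
  have between: "entry ?\<beta> (2 * k + 1) \<prec> entry ?\<beta> (2 * k) \<longleftrightarrow> entry \<gamma> (k + 1) \<prec> entry \<gamma> k"
    if "k \<in> {1..n}" for k
  proof -
    \<comment> \<open>Distinct absolute values in \<open>\<gamma>\<close> become at least 2 apart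
      after doubling, so subtracting 0 or 1 leaves their comparison unchanged.\<close>
    have "\<bar>entry \<gamma> (k + 1)\<bar> \<noteq> \<bar>entry \<gamma> k\<bar>"
      by (simp add: entry_def signed_perms_abs_eq_iff[OF \<gamma>])
    then show ?thesis
      using that nz[of k] nz[of "k + 1"] entry_double(1)[of "k + 1" \<gamma> E] entry_double(2)[of k \<gamma> E]
      by (auto simp: prec_def sgn_if)
  qed
  have "maj (2 * n) ?\<beta> =
      (\<Sum>k = 1..n. of_bool (k \<in> E) * (2 * k - 1) + of_bool (entry \<gamma> (k + 1) \<prec> entry \<gamma> k) * (2 * k))"
    unfolding maj_eq_sum[OF double_signed_perms[OF \<gamma> E]] sum_pairs
    by (intro sum.cong refl) (simp only: within between)
  also have "\<dots> = (\<Sum>k = 1..n. of_bool (k \<in> E) * (2 * k - 1)) + 2 * maj n \<gamma>"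
    unfolding sum.distrib maj_eq_sum[OF \<gamma>] sum_distrib_left by (simp only: mult_ac)
  also have "(\<Sum>k = 1..n. of_bool (k \<in> E) * (2 * k - 1)) = (\<Sum>k \<in> E. 2 * k - 1)"
    using E by (intro sum.mono_neutral_cong_right) auto
  finally show ?thesis by simp
qed

lemma fmaj_double: "fmaj (2 * n) (double \<gamma> E) = 2 * fmaj n \<gamma> + (\<Sum>k \<in> E. 4 * k - 2)"
proof -
  have "2 * (\<Sum>k \<in> E. 2 * k - 1) = (\<Sum>k \<in> E. 4 * k - 2)"
    by (simp add: sum_distrib_left diff_mult_distrib2)
  then show ?thesis by (simp add: fmaj_def N1_double maj_double)
qed

text \<open>Two different position pairs contribute four inversions or none, so modulo 2 only the
  inversions inside a pair count, one for each \<open>k \<in> E\<close>.\<close>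

lemma abs_inversions_double:
  "(- 1 :: 'a :: comm_ring_1) ^ card (abs_inversions (2 * n) (double \<gamma> E)) = (- 1) ^ card E"
proof -
  let ?\<beta> = "double \<gamma> E"
  define T :: "nat \<Rightarrow> nat \<Rightarrow> nat"
    where "T i j = of_bool (i < j \<and> \<bar>entry ?\<beta> i\<bar> > \<bar>entry ?\<beta> j\<bar>)" for i j
  define U :: "nat \<Rightarrow> nat \<Rightarrow> nat"
    where "U k l = of_bool (k < l \<and> \<bar>entry \<gamma> k\<bar> > \<bar>entry \<gamma> l\<bar>)" for k l
  have abs: "\<bar>entry ?\<beta> (2 * k - 1)\<bar> = 2 * \<bar>entry \<gamma> k\<bar> - of_bool (k \<notin> E)"
      "\<bar>entry ?\<beta> (2 * k)\<bar> = 2 * \<bar>entry \<gamma> k\<bar> - of_bool (k \<in> E)" if "k \<ge> 1" for k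
  proof -
    have "entry \<gamma> k \<noteq> 0"
      using that by (simp add: entry_def signed_perms_eq_0_iff[OF \<gamma>])
    then show "\<bar>entry ?\<beta> (2 * k - 1)\<bar> = 2 * \<bar>entry \<gamma> k\<bar> - of_bool (k \<notin> E)"
      "\<bar>entry ?\<beta> (2 * k)\<bar> = 2 * \<bar>entry \<gamma> k\<bar> - of_bool (k \<in> E)"
      using entry_double[OF that, of \<gamma> E] by (auto simp: abs_mult sgn_if)
  qed
  \<comment> \<open>All comparisons from pair \<open>k\<close> to pair \<open>l\<close>: on the
    diagonal they are internal to a pair, and for \<open>k > l\<close> every term vanishes because
    the positions are in the wrong order.\<close>
  have T: "T (2 * k - 1) (2 * l - 1) + T (2 * k) (2 * l - 1) + (T (2 * k - 1) (2 * l) + T (2 * k) (2 * l))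
      = (if k = l then of_bool (k \<in> E) else 0) + 4 * U k l" if kl: "k \<in> {1..n}" "l \<in> {1..n}" for k l
  proof (cases k l rule: linorder_cases)
    case less
    then have "\<bar>entry \<gamma> k\<bar> \<noteq> \<bar>entry \<gamma> l\<bar>"
      by (simp add: entry_def signed_perms_abs_eq_iff[OF \<gamma>])
    moreover have "2 * k - 1 < 2 * l - 1" "2 * k - 1 < 2 * l" "2 * k < 2 * l - 1" "2 * k < 2 * l"
      using less kl by auto
    moreover have "2 * a - of_bool p < 2 * b - of_bool q \<longleftrightarrow> a < b" if "a \<noteq> b" for a b :: int and p q
      using that by (auto simp: of_bool_def)
    ultimately show ?thesis
      using less kl by (simp add: T_def U_def abs del: One_nat_def)
  next
    case equal
    have "2 * l - 1 < 2 * l" using kl by auto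
    then show ?thesis using equal kl by (simp add: T_def U_def abs del: One_nat_def)
  next
    case greater
    then have "\<not> 2 * k - 1 < 2 * l - 1" "\<not> 2 * k - 1 < 2 * l" "\<not> 2 * k < 2 * l - 1" "\<not> 2 * k < 2 * l"
      using kl by auto
    then show ?thesis using greater by (simp add: T_def U_def)
  qed
  have "card (abs_inversions (2 * n) ?\<beta>) = (\<Sum>i = 1..2 * n. \<Sum>j = 1..2 * n. T i j)"
    by (simp add: card_abs_inversions_eq_sum T_def)
  also have "\<dots> = (\<Sum>k = 1..n. \<Sum>l = 1..n.
      T (2 * k - 1) (2 * l - 1) + T (2 * k) (2 * l - 1) + (T (2 * k - 1) (2 * l) + T (2 * k) (2 * l)))"
    unfolding sum_pairs by (simp add: sum.distrib add_ac)
  also have "\<dots> = (\<Sum>k = 1..n. \<Sum>l = 1..n. (if k = l then of_bool (k \<in> E) else 0) + 4 * U k l)"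
    by (intro sum.cong refl T)
  also have "\<dots> = (\<Sum>k = 1..n. of_bool (k \<in> E)) + 4 * (\<Sum>k = 1..n. \<Sum>l = 1..n. U k l)"
    by (simp add: sum.distrib sum_distrib_left)
  also have "(\<Sum>k = 1..n. of_bool (k \<in> E)) = card E"
    using E by (simp add: Int_absorb1)
  finally show ?thesis by (simp add: power_add power_mult)
qed

text \<open>\<open>N1\<close> doubles, so its sign is trivial; the sign
  \<open>(- 1) ^ card E\<close> is spread over the factors indexed by \<open>E\<close>.\<close>

lemma weight_double:
  "weight (2 * n) (double \<gamma> E) = monom 1 (2 * fmaj n \<gamma>) * (\<Prod>k \<in> E. - monom 1 (4 * k - 2))"
proof -
  have "finite E" using E finite_subset by blast
  then have "(\<Prod>k \<in> E. - monom (1 :: int) (4 * k - 2)) = (- 1) ^ card E * monom 1 (\<Sum>k \<in> E. 4 * k - 2)"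
    by (induction E rule: finite_induct) (simp_all add: mult_monom)
  moreover have "weight (2 * n) (double \<gamma> E) =
      (- 1) ^ card E * monom 1 (2 * fmaj n \<gamma> + (\<Sum>k \<in> E. 4 * k - 2))"
    by (simp add: weight_def length_B_parity[OF double_signed_perms[OF \<gamma> E]] N1_double
        abs_inversions_double fmaj_double power_mult)
  ultimately show ?thesis
    by (simp add: mult_monom mult.left_commute[of "monom 1 (2 * fmaj n \<gamma>)"])
qed

end

section \<open>Summation over \<open>\<gamma>\<close> and \<open>E\<close>\<close>

theorem theorem3p2:
  fixes n :: nat
  assumes "n > 0"
  shows "(\<Sum>\<beta> \<in> signed_perms (2 * n). (- 1) ^ length_B (2 * n) \<beta> * monom (1 :: int) (fmaj (2 * n) \<beta>))
       = (\<Prod>i = 1..n. 1 - monom 1 (4 * i - 2)) * (\<Sum>\<beta> \<in> signed_perms n. monom 1 (2 * fmaj n \<beta>))"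
proof -
  let ?S = "{\<beta> \<in> signed_perms (2 * n). \<forall>k \<in> {1..int n}. aligned (2 * n) k \<beta>}"
  let ?T = "signed_perms n \<times> Pow {1..n}"
  \<comment> \<open>Doubling lands among the surviving permutations, because subtracting 0 or 1 from
    the doubled absolute value changes neither block nor sign.\<close>
  have aligned_double: "aligned (2 * n) v (double \<gamma> E)"
    if "\<gamma> \<in> signed_perms n" "E \<subseteq> {1..n}" "v \<in> {1..int n}" for \<gamma> E v
  proof -
    have "block (entry (double \<gamma> E) (2 * k - 1)) = block (entry (double \<gamma> E) (2 * k)) \<and>
       sgn (entry (double \<gamma> E) (2 * k - 1)) = sgn (entry (double \<gamma> E) (2 * k))" if "k \<in> {1..n}" for k
    proof -
      have "entry \<gamma> k \<noteq> 0"
        using that by (simp add: entry_def signed_perms_eq_0_iff[OF \<open>\<gamma> \<in> signed_perms n\<close>])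
      then have "block (sgn (entry \<gamma> k) * (2 * \<bar>entry \<gamma> k\<bar> - of_bool b)) = \<bar>entry \<gamma> k\<bar>"
        "sgn (sgn (entry \<gamma> k) * (2 * \<bar>entry \<gamma> k\<bar> - of_bool b)) = sgn (entry \<gamma> k)" for b
        by (auto simp: block_eq_iff abs_mult sgn_if)
      then show ?thesis
        using that by (simp add: entry_double del: One_nat_def)
    qed
    then show ?thesis
      using aligned_iff_paired[OF double_signed_perms] that by blast
  qed
  have "(\<Sum>\<beta> \<in> signed_perms (2 * n). weight (2 * n) \<beta>) = (\<Sum>\<beta> \<in> ?S. weight (2 * n) \<beta>)"
    by (rule sum_weight_aligned) auto
  also have "\<dots> = (\<Sum>(\<gamma>, E) \<in> ?T. weight (2 * n) (double \<gamma> E))"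
  \<comment> \<open>By \<open>aligned_iff_paired\<close> the members of \<open>?S\<close> are the
    paired permutations, on which \<open>halve\<close> and \<open>pair_descents\<close> together
    invert \<open>double\<close>.\<close>
  proof (rule sum.reindex_bij_witness[of _ "\<lambda>(\<gamma>, E). double \<gamma> E" "\<lambda>\<beta>. (halve \<beta>, pair_descents n \<beta>)"])
    fix \<beta> assume \<beta>: "\<beta> \<in> ?S"
    then have \<beta>': "\<beta> \<in> signed_perms (2 * n)" by simp
    have paired: "block (entry \<beta> (2 * k - 1)) = block (entry \<beta> (2 * k)) \<and>
        sgn (entry \<beta> (2 * k - 1)) = sgn (entry \<beta> (2 * k))" if "k \<in> {1..n}" for k
      using \<beta> that aligned_iff_paired[OF \<beta>'] by blast
    show "(case (halve \<beta>, pair_descents n \<beta>) of (\<gamma>, E) \<Rightarrow> double \<gamma> E) = \<beta>"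
      using double_halve[OF \<beta>' paired] by simp
    then show "(case (halve \<beta>, pair_descents n \<beta>) of (\<gamma>, E) \<Rightarrow> weight (2 * n) (double \<gamma> E))
        = weight (2 * n) \<beta>" by simp
    show "(halve \<beta>, pair_descents n \<beta>) \<in> ?T"
      using halve_signed_perms[OF \<beta>' paired] by (auto simp: pair_descents_def)
  qed (auto simp: halve_double pair_descents_double double_signed_perms aligned_double)
  also have "\<dots> = (\<Sum>(\<gamma>, E) \<in> ?T. monom 1 (2 * fmaj n \<gamma>) * (\<Prod>k \<in> E. - monom 1 (4 * k - 2)))"
    by (intro sum.cong) (auto simp: weight_double)
  also have "\<dots> = (\<Sum>\<gamma> \<in> signed_perms n. monom 1 (2 * fmaj n \<gamma>)) *
      (\<Sum>E \<in> Pow {1..n}. \<Prod>k \<in> E. - monom 1 (4 * k - 2))"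
    by (simp add: sum_product sum.cartesian_product)
  \<comment> \<open>Expanding the product chooses the monomial or 1 for each \<open>k\<close>;
    \<open>E\<close> is the set where the monomial is chosen.\<close>
  also have "(\<Sum>E \<in> Pow {1..n}. \<Prod>k \<in> E. - monom (1 :: int) (4 * k - 2)) =
      (\<Prod>k = 1..n. - monom 1 (4 * k - 2) + 1)"
    by (subst prod_add) simp_all
  finally show ?thesis by (simp add: weight_def mult.commute)
qed

end
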